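(* Let $k\ge1$ be an integer, $H\in\mathbb{F}_q[x]$, and let $D_1,D_2$ be monic polynomials with $D_1^k\mid H$ and $D_2^k\mid H$. Then $$\phi_k(D_2)\,\eta_k\!\left(\frac{H}{D_2^k},D_1\right)=\phi_k(D_1)\,\eta_k\!\left(\frac{H}{D_1^k},D_2\right).$$
   Context: Let $\mathbb{F}_q$ be a finite field with $q$ elements and fix a non-trivial homomorphism $\lambda:(\mathbb{F}_q,+)\to\mathbb{C}^*$. For nonzero $M\in\mathbb{F}_q[x]$ of degree $m\ge1$ and $A\in\mathbb{F}_q[x]$, let $t_M(A)$ be the coefficient of $x^{m-1}$ in the remainder of $A$ on division by $M$ (if $m=0$, $t_M(A)=0$), and $E(G,M)(A)=\lambda(t_M(GA))$. For $A,B$ not both zero, $(A,B)_k$ is the monic polynomial of the form $C^k$ of largest degree dividing both $A$ and $B$. For nonzero $D$, $\eta_k(G,D)=\sum_{R}E(G,D^k)(R)$, where $R$ runs over a complete residue system modulo $D^k$ with $(R,D^k)_k=1$. $|A|=q^{\deg A}$, and $\phi_k(D)=|D|^k\prod_{P}(1-|P|^{-k})$, the product over monic irreducible $P$ dividing $D$. *)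

theory Defs
  imports Complex_Main "HOL-Library.Cardinality"
    "HOL-Computational_Algebra.Polynomial"
begin

definition tcoeff :: "'a::field poly \<Rightarrow> 'a poly \<Rightarrow> 'a" where
  "tcoeff M A = (if degree M = 0 then 0 else coeff (A mod M) (degree M - 1))"

definition E_char :: "('a::field \<Rightarrow> complex) \<Rightarrow> 'a poly \<Rightarrow> 'a poly \<Rightarrow> 'a poly \<Rightarrow> complex" where
  "E_char lam G M A = lam (tcoeff M (G * A))"

definition is_kgcd :: "nat \<Rightarrow> 'a::field poly \<Rightarrow> 'a poly \<Rightarrow> 'a poly \<Rightarrow> bool" where
  "is_kgcd k A B G \<longleftrightarrow>
     is_arg_max degree
       (\<lambda>G. lead_coeff G = 1 \<and> (\<exists>C. G = C ^ k) \<and> G dvd A \<and> G dvd B) G"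

definition kgcd :: "nat \<Rightarrow> 'a::field poly \<Rightarrow> 'a poly \<Rightarrow> 'a poly" where
  "kgcd k A B = (THE G. is_kgcd k A B G)"

(* The sum runs over the reduced representatives modulo D ^ k. By eta_complete_residue_system
   below, any other complete residue system gives the same value. *)
definition eta :: "('a::field \<Rightarrow> complex) \<Rightarrow> nat \<Rightarrow> 'a poly \<Rightarrow> 'a poly \<Rightarrow> complex" where
  "eta lam k G D =
     (\<Sum>R | R mod D ^ k = R \<and> kgcd k R (D ^ k) = 1. E_char lam G (D ^ k) R)"

definition pnorm :: "'a::{field,finite} poly \<Rightarrow> real" where
  "pnorm A = (if A = 0 then 0 else real CARD('a) ^ degree A)"

definition phi :: "nat \<Rightarrow> 'a::{field,finite} poly \<Rightarrow> real" where
  "phi k D = pnorm D ^ k *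
     (\<Prod>P | irreducible P \<and> lead_coeff P = 1 \<and> P dvd D. 1 - 1 / pnorm P ^ k)"

definition complete_residue_system :: "'a::field poly \<Rightarrow> 'a poly set \<Rightarrow> bool" where
  "complete_residue_system M S \<longleftrightarrow> (\<forall>A. \<exists>!R. R \<in> S \<and> R mod M = A mod M)"

lemma kgcd_mod: "kgcd k (R mod M) M = kgcd k R M"
proof -
  have "G dvd R mod M \<and> G dvd M \<longleftrightarrow> G dvd R \<and> G dvd M" for G
    by (metis dvd_mod_iff)
  then show ?thesis by (simp add: kgcd_def is_kgcd_def)
qed

lemma E_char_mod: "E_char lam G M (R mod M) = E_char lam G M R"
  by (simp add: E_char_def tcoeff_def mod_mult_right_eq)

lemma eta_complete_residue_system:
  assumes S: "complete_residue_system (D ^ k) S"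
  shows "(\<Sum>R | R \<in> S \<and> kgcd k R (D ^ k) = 1. E_char lam G (D ^ k) R) = eta lam k G D"
proof -
  let ?M = "D ^ k"
  have "bij_betw (\<lambda>R. R mod ?M) {R. R \<in> S \<and> kgcd k R ?M = 1}
          {R. R mod ?M = R \<and> kgcd k R ?M = 1}"
  proof (rule bij_betwI')
    fix X Y assume "X \<in> {R. R \<in> S \<and> kgcd k R ?M = 1}" "Y \<in> {R. R \<in> S \<and> kgcd k R ?M = 1}"
    then show "X mod ?M = Y mod ?M \<longleftrightarrow> X = Y"
      using S unfolding complete_residue_system_def by blast
  next
    fix X assume "X \<in> {R. R \<in> S \<and> kgcd k R ?M = 1}"
    then show "X mod ?M \<in> {R. R mod ?M = R \<and> kgcd k R ?M = 1}"
      by (simp add: kgcd_mod)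
  next
    fix Y assume Y: "Y \<in> {R. R mod ?M = R \<and> kgcd k R ?M = 1}"
    obtain X where X: "X \<in> S" "X mod ?M = Y mod ?M"
      using S unfolding complete_residue_system_def by blast
    have "kgcd k X ?M = 1"
      using X Y kgcd_mod[of k X ?M] by simp
    with X Y show "\<exists>X\<in>{R. R \<in> S \<and> kgcd k R ?M = 1}. Y = X mod ?M"
      by auto
  qed
  then show ?thesis
    unfolding eta_def by (simp flip: sum.reindex_bij_betw add: E_char_mod)
qed

lemma kgcd_exists:
  fixes A B :: "'a::field poly"
  assumes "A \<noteq> 0 \<or> B \<noteq> 0"
  shows "\<exists>G. is_kgcd k A B G"
proof -
  let ?P = "\<lambda>G. lead_coeff G = 1 \<and> (\<exists>C. G = C ^ k) \<and> G dvd A \<and> G dvd B"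
  have P1: "?P 1" by (auto intro: exI[of _ 1])
  have "\<forall>G. ?P G \<longrightarrow> degree G < Suc (max (degree A) (degree B))"
    using assms by (auto dest!: dvd_imp_degree_le simp: less_Suc_eq_le)
  from ex_has_greatest_nat[OF P1 this] show ?thesis
    unfolding is_kgcd_def is_arg_max_linorder by blast
qed

lemma poly_bezout:
  fixes A B :: "'a::field poly"
  shows "\<exists>g u v. g dvd A \<and> g dvd B \<and> g = u * A + v * B"
proof (induction "euclidean_size B" arbitrary: A B rule: less_induct)
  case less
  show ?case
  proof (cases "B = 0")
    case True
    then show ?thesis by (intro exI[of _ A] exI[of _ 1]) auto
  next
    case False
    then have "euclidean_size (A mod B) < euclidean_size B" by (rule mod_size_less)
    from less[OF this, of B] obtain g u v
      where g: "g dvd B" "g dvd A mod B" "g = u * B + v * (A mod B)" by blast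
    have "g = v * A + (u - v * (A div B)) * B"
      using g(3) by (simp add: minus_div_mult_eq_mod[symmetric] algebra_simps)
    moreover have "g dvd A" using g(1,2) by (simp add: dvd_mod_iff)
    ultimately show ?thesis using g(1) by blast
  qed
qed

lemma comaximal_mult:
  fixes a b c :: "'a::comm_ring_1"
  assumes "\<exists>u v. u * a + v * b = 1" "\<exists>u v. u * a + v * c = 1"
  shows "\<exists>u v. u * a + v * (b * c) = 1"
proof -
  from assms obtain u v s t where *: "u * a + v * b = 1" "s * a + t * c = 1" by blast
  have "(u * s * a + u * t * c + v * b * s) * a + (v * t) * (b * c)
      = (u * a + v * b) * (s * a + t * c)"
    by (simp add: algebra_simps)
  with * show ?thesis by (metis mult_1)
qed

lemma comaximal_power:
  fixes a b :: "'a::comm_ring_1"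
  assumes "\<exists>u v. u * a + v * b = 1"
  shows "\<exists>u v. u * a + v * b ^ n = 1"
proof (induction n)
  case 0
  show ?case by (intro exI[of _ 0] exI[of _ 1]) simp
next
  case (Suc n)
  then show ?case using comaximal_mult[OF assms Suc] by simp
qed

lemma kth_power_lcm:
  fixes g a b A :: "'a::idom"
  assumes comax: "\<exists>u v. u * a + v * b = 1"
    and dvd: "(g * a) ^ k dvd A" "(g * b) ^ k dvd A"
  shows "(g * a * b) ^ k dvd A"
proof (cases "g = 0")
  case True
  with dvd show ?thesis by simp
next
  case False
  obtain X where X: "A = (g * a) ^ k * X" using dvd(1) by blast
  have "g ^ k * b ^ k dvd g ^ k * (a ^ k * X)"
    using dvd(2) X by (simp add: power_mult_distrib mult_ac)
  then have d: "b ^ k dvd a ^ k * X" using False by simp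
  have "\<exists>u v. u * a + v * b ^ k = 1" using comax by (rule comaximal_power)
  then have "\<exists>u v. u * b ^ k + v * a = 1" by (metis add.commute)
  then have "\<exists>u v. u * b ^ k + v * a ^ k = 1" by (rule comaximal_power)
  then obtain u v where uv: "u * b ^ k + v * a ^ k = 1" by blast
  have "X = (u * b ^ k + v * a ^ k) * X" using uv by simp
  also have "\<dots> = b ^ k * (u * X) + v * (a ^ k * X)" by (simp add: algebra_simps)
  finally have "b ^ k dvd X" using d by (metis dvd_add dvd_mult dvd_triv_left)
  then show ?thesis using X by (simp add: power_mult_distrib mult_dvd_mono)
qed

lemma kgcd_unique:
  fixes A B :: "'a::field poly"
  assumes k: "k \<ge> 1" and G: "is_kgcd k A B G" and G': "is_kgcd k A B G'"
  shows "G = G'"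
proof -
  let ?P = "\<lambda>G. lead_coeff G = 1 \<and> (\<exists>C. G = C ^ k) \<and> G dvd A \<and> G dvd B"
  from G obtain C where C: "G = C ^ k" "?P G" and maxG: "\<And>F. ?P F \<Longrightarrow> degree F \<le> degree G"
    unfolding is_kgcd_def is_arg_max_linorder by blast
  from G' obtain C' where C': "G' = C' ^ k" "?P G'" and maxG': "\<And>F. ?P F \<Longrightarrow> degree F \<le> degree G'"
    unfolding is_kgcd_def is_arg_max_linorder by blast
  have "C \<noteq> 0" "C' \<noteq> 0" using C C' k by (auto simp: zero_power)
  obtain g u v where g: "g dvd C" "g dvd C'" "g = u * C + v * C'"
    using poly_bezout by blast
  obtain a b where ab: "C = g * a" "C' = g * b" using g(1,2) unfolding dvd_def by blast
  have nz: "g \<noteq> 0" "a \<noteq> 0" "b \<noteq> 0" using ab \<open>C \<noteq> 0\<close> \<open>C' \<noteq> 0\<close> by auto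
  have "g * (u * a + v * b) = g * 1" using g(3) ab by (simp add: algebra_simps)
  then have comax: "\<exists>u v. u * a + v * b = 1" using nz by (metis mult_left_cancel)
  define L where "L = g * a * b"
  have "L \<noteq> 0" using nz by (simp add: L_def)
  define c where "c = inverse (lead_coeff L)"
  have c: "c \<noteq> 0" using \<open>L \<noteq> 0\<close> by (simp add: c_def)
  have "L ^ k dvd A" "L ^ k dvd B"
    unfolding L_def using C C' ab by (simp_all add: kth_power_lcm[OF comax])
  then have "(smult c L) ^ k dvd A" "(smult c L) ^ k dvd B"
    using c by (simp_all add: smult_power smult_dvd_iff)
  moreover have "lead_coeff ((smult c L) ^ k) = 1"
    using \<open>L \<noteq> 0\<close> by (simp only: lead_coeff_power lead_coeff_smult c_def) simp
  ultimately have P: "?P ((smult c L) ^ k)" by blast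
  have degL: "degree ((smult c L) ^ k) = k * (degree g + degree a + degree b)"
    using c nz by (simp add: degree_power_eq L_def degree_mult_eq)
  have "degree G = k * (degree g + degree a)" "degree G' = k * (degree g + degree b)"
    using C(1) C'(1) ab nz by (simp_all add: degree_power_eq degree_mult_eq)
  with maxG[OF P] maxG'[OF P] degL k have "degree a = 0" "degree b = 0"
    by auto
  then obtain x y where xy: "a = [:x:]" "b = [:y:]" by (auto elim!: degree_eq_zeroE)
  have "G = smult (x ^ k) (g ^ k)" "G' = smult (y ^ k) (g ^ k)"
    using C(1) C'(1) ab xy by (simp_all add: smult_power)
  moreover from this C(2) C'(2) have "x ^ k * lead_coeff (g ^ k) = y ^ k * lead_coeff (g ^ k)"
    by (metis lead_coeff_smult)
  moreover have "lead_coeff (g ^ k) \<noteq> 0" using nz by simp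
  ultimately show ?thesis by auto
qed

lemma is_kgcd_kgcd:
  assumes "k \<ge> 1" "A \<noteq> 0 \<or> B \<noteq> 0"
  shows "is_kgcd k A B (kgcd k A B)"
  unfolding kgcd_def
proof (rule theI')
  show "\<exists>!G. is_kgcd k A B G"
    using kgcd_exists[OF assms(2)] kgcd_unique[OF assms(1)] by blast
qed

end

theory Submission
  imports Defs
begin

text \<open>
  Let \<open>N\<close> be the monic gcd of \<open>D1\<close> and \<open>D2\<close>, and write \<open>D1 = A N\<close>, \<open>D2 = B N\<close>; then \<open>(A B N)^k\<close>
  divides \<open>H\<close>. If \<open>G = A^k G'\<close>, the character \<open>E(G, (A N)^k)\<close> equals \<open>E(G', N^k)\<close>, and reduction
  modulo \<open>N^k\<close> maps the \<open>k\<close>-reduced residues modulo \<open>(A N)^k\<close> onto those modulo \<open>N^k\<close> with all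
  fibres of size \<open>\<phi>_k(A N) / \<phi>_k(N)\<close>. Hence \<open>\<phi>_k(N) \<eta>_k(G, A N) = \<phi>_k(A N) \<eta>_k(G', N)\<close>. For
  \<open>G = H / D2^k\<close> on \<open>D1\<close> and for \<open>G = H / D1^k\<close> on \<open>D2\<close> the reduced argument \<open>G'\<close> is the same, namely
  \<open>H / (A B N)^k\<close>, so both sides of the claim multiplied by \<open>\<phi>_k(N)\<close> agree. The fibres are
  counted by enlarging the modulus by one irreducible factor at a time.
\<close>

section \<open>Irreducible polynomials over a field\<close>

text \<open>A divisor of least positive degree, made monic, cannot split into two nonconstant
  factors, since each would be a divisor of smaller positive degree.\<close>

lemma exists_monic_irreducible_dvd:
  fixes A :: "'a::field poly"
  assumes "degree A > 0"
  shows "\<exists>P. irreducible P \<and> lead_coeff P = 1 \<and> P dvd A"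
proof -
  define Q where "Q = arg_min degree (\<lambda>P. P dvd A \<and> degree P > 0)"
  have Q: "Q dvd A \<and> degree Q > 0"
    unfolding Q_def by (rule arg_min_natI[where k = A]) (use assms in auto)
  have least: "degree Q \<le> degree R" if "R dvd A" "degree R > 0" for R
    unfolding Q_def by (rule arg_min_nat_le) (use that in auto)
  define P where "P = smult (inverse (lead_coeff Q)) Q"
  have "Q \<noteq> 0" using Q by auto
  then have PA: "P dvd A" and deg: "degree P = degree Q" and monic: "lead_coeff P = 1"
    using Q by (auto simp: P_def smult_dvd_iff)
  have "irreducible P"
  proof (rule irreducibleI)
    show "P \<noteq> 0" using monic by auto
    then show "\<not> P dvd 1" using deg Q is_unit_iff_degree[of P] by auto
    fix a b assume ab: "P = a * b"
    then have nz: "a \<noteq> 0" "b \<noteq> 0" using \<open>P \<noteq> 0\<close> by auto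
    have "degree b = 0" if "degree a > 0"
    proof -
      have "a dvd A" using ab PA dvd_mult_left by blast
      then have "degree Q \<le> degree a" using least that by blast
      moreover have "degree Q = degree a + degree b"
        using deg ab nz by (simp add: degree_mult_eq)
      ultimately show ?thesis by simp
    qed
    then show "a dvd 1 \<or> b dvd 1" using nz is_unit_iff_degree by blast
  qed
  then show ?thesis using PA monic by blast
qed

lemma irreducible_poly_degree_pos:
  fixes P :: "'a::field poly"
  assumes "irreducible P"
  shows "degree P > 0"
proof (rule ccontr)
  assume "\<not> degree P > 0"
  then have "is_unit P" using assms is_unit_iff_degree[of P] by (auto simp: irreducible_def)
  with assms show False by (simp add: irreducible_def)
qed

text \<open>The common divisor \<open>g\<close> from Bezout is a unit: otherwise its cofactor in
  \<open>P\<close> is one, so \<open>P\<close> divides \<open>g\<close> and hence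
  \<open>M\<close>.\<close>

lemma irreducible_poly_comaximal:
  fixes P M :: "'a::field poly"
  assumes P: "irreducible P" and nd: "\<not> P dvd M"
  shows "\<exists>u v. u * P + v * M = 1"
proof -
  obtain g u v where g: "g dvd P" "g dvd M" "g = u * P + v * M"
    using poly_bezout by blast
  obtain h where h: "P = g * h" using g(1) by blast
  have "\<not> h dvd 1"
  proof
    assume "h dvd 1"
    then have "P dvd g" using h by (metis dvd_mult_unit_iff dvd_refl mult.commute)
    with g(2) nd show False using dvd_trans by blast
  qed
  with P h have "g dvd 1" by (auto dest: irreducibleD)
  then obtain w where "g * w = 1" by (metis dvdE)
  then have "(w * u) * P + (w * v) * M = 1" using g(3) by (simp add: algebra_simps)
  then show ?thesis by blast
qed

lemma irreducible_poly_dvd_mult: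
  fixes P :: "'a::field poly"
  assumes "irreducible P" "P dvd A * B" "\<not> P dvd A"
  shows "P dvd B"
proof -
  obtain u v where "u * P + v * A = 1" using irreducible_poly_comaximal assms(1,3) by blast
  then have "B = P * (u * B) + v * (A * B)"
    by (metis (no_types, opaque_lifting) distrib_right mult.assoc mult.commute mult_1)
  then show ?thesis using assms(2) by (metis dvd_add dvd_mult dvd_triv_left)
qed

lemma irreducible_poly_dvd_power:
  fixes P :: "'a::field poly"
  assumes "irreducible P" "P dvd A ^ n"
  shows "P dvd A"
  using assms(2)
proof (induction n)
  case 0
  with assms(1) show ?case by (simp add: irreducible_def)
next
  case (Suc n)
  then show ?case using irreducible_poly_dvd_mult[OF assms(1), of A "A ^ n"] by auto
qed

lemma monic_irreducible_dvd_irreducible: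
  fixes P Q :: "'a::field poly"
  assumes "irreducible P" "lead_coeff P = 1" "irreducible Q" "lead_coeff Q = 1" "Q dvd P"
  shows "Q = P"
proof -
  obtain h where h: "P = Q * h" using assms(5) by blast
  then have "h dvd 1" using assms(1,3) by (auto simp: irreducible_def)
  moreover have "h \<noteq> 0" using h assms(1) by auto
  ultimately obtain c where "h = [:c:]" using is_unit_iff_degree degree_eq_zeroE by metis
  moreover have "lead_coeff h = 1" using h assms(2,4) by (simp add: lead_coeff_mult)
  ultimately show ?thesis using h by simp
qed

section \<open>Residues modulo a polynomial over a finite field\<close>

text \<open>Vanishing of coefficients, unlike a strict bound on \<open>degree\<close>, includes the
  zero polynomial also for \<open>n = 0\<close>. In the induction \<open>pCons\<close> splits off
  the constant coefficient, which is free.\<close>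

lemma finite_card_coeff_vanish:
  fixes n :: nat
  defines "V \<equiv> \<lambda>n. {p :: 'a::{field,finite} poly. \<forall>i\<ge>n. coeff p i = 0}"
  shows "finite (V n) \<and> card (V n) = CARD('a) ^ n"
proof (induction n)
  case 0
  have "V 0 = {0}" by (auto simp: V_def poly_eq_iff)
  then show ?case by simp
next
  case (Suc n)
  have "V (Suc n) = (\<lambda>(a, p). pCons a p) ` (UNIV \<times> V n)"
  proof (intro equalityI subsetI)
    fix p assume "p \<in> V (Suc n)"
    then show "p \<in> (\<lambda>(a, p). pCons a p) ` (UNIV \<times> V n)"
      by (cases p) (force simp: V_def image_iff coeff_pCons dest: spec[of _ "Suc _"])
  qed (auto simp: V_def coeff_pCons split: nat.split)
  moreover have "inj_on (\<lambda>(a, p). pCons a p) (UNIV \<times> V n)" by (auto simp: inj_on_def)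
  ultimately show ?case using Suc by (simp add: card_image card_cartesian_product)
qed

lemma residues_eq_coeff_vanish:
  fixes M :: "'a::field poly"
  assumes "M \<noteq> 0"
  shows "{R. R mod M = R} = {R. \<forall>i\<ge>degree M. coeff R i = 0}"
proof (intro set_eqI iffI; clarsimp)
  fix R :: "'a poly" and i assume "R mod M = R" "degree M \<le> i"
  then show "coeff R i = 0"
    using degree_mod_less'[OF assms, of R] by (metis coeff_0 coeff_eq_0 le_trans linorder_not_less)
next
  fix R :: "'a poly" assume *: "\<forall>i\<ge>degree M. coeff R i = 0"
  show "R mod M = R"
  proof (cases "R = 0")
    case False
    then have "degree R < degree M" using * by (metis leading_coeff_0_iff linorder_not_less)
    then show ?thesis by (rule mod_poly_less)
  qed simp
qed

lemma
  fixes M :: "'a::{field,finite} poly"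
  assumes "M \<noteq> 0"
  shows finite_residues: "finite {R. R mod M = R}"
    and card_residues: "card {R. R mod M = R} = CARD('a) ^ degree M"
  using finite_card_coeff_vanish[of "degree M", where 'a = 'a]
  by (simp_all add: residues_eq_coeff_vanish[OF assms])

lemma finite_poly_divisors:
  fixes M :: "'a::{field,finite} poly"
  assumes "M \<noteq> 0"
  shows "finite {Q. Q dvd M}"
proof (rule finite_subset)
  show "{Q. Q dvd M} \<subseteq> {Q. \<forall>i\<ge>Suc (degree M). coeff Q i = 0}"
    using assms by (auto dest!: dvd_imp_degree_le intro!: coeff_eq_0)
  show "finite {Q :: 'a poly. \<forall>i\<ge>Suc (degree M). coeff Q i = 0}"
    using finite_card_coeff_vanish by blast
qed

text \<open>\<open>R mod M\<close> and \<open>R div M\<close> act as two digits of \<open>R\<close>: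
  reduction modulo \<open>P * M\<close> keeps the first and reduces the second modulo
  \<open>P\<close>.\<close>

lemma residues_mult_bij:
  fixes M P :: "'a::field poly"
  assumes "M \<noteq> 0"
  shows "bij_betw (\<lambda>(S, T). S + M * T)
           ({S. S mod M = S} \<times> {T. T mod P = T}) {R. R mod (P * M) = R}"
proof (rule bij_betw_byWitness[where f' = "\<lambda>R. (R mod M, R div M)"])
  have div0: "S div M = 0" if "S mod M = S" for S
    using that div_mult_mod_eq[of S M] assms by simp
  have red: "(S + M * T) mod (P * M) = S + M * T"
    if "S mod M = S" "T mod P = T" for S T
  proof -
    have "(S + M * T) div M = T" "(S + M * T) mod M = S"
      using assms that(1) div0 by simp_all
    moreover have "(S + M * T) mod (M * P) =
        M * ((S + M * T) div M mod P) + (S + M * T) mod M"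
      by (rule poly_mod_mult_right)
    ultimately show ?thesis using that(2) by (simp add: mult.commute)
  qed
  show "(\<lambda>(S, T). S + M * T) ` ({S. S mod M = S} \<times> {T. T mod P = T}) \<subseteq> {R. R mod (P * M) = R}"
    using red by auto
  show "(\<lambda>R. (R mod M, R div M)) ` {R. R mod (P * M) = R} \<subseteq> {S. S mod M = S} \<times> {T. T mod P = T}"
  proof clarsimp
    fix R assume "R mod (P * M) = R"
    then have "M * (R div M mod P) + R mod M = M * (R div M) + R mod M"
      by (metis mult.commute mult_div_mod_eq poly_mod_mult_right)
    then have "M * (R div M mod P) = M * (R div M)" by (rule add_right_imp_eq)
    then show "R div M mod P = R div M" using assms by simp
  qed
  show "\<forall>x\<in>{S. S mod M = S} \<times> {T. T mod P = T}.
      ((case x of (S, T) \<Rightarrow> S + M * T) mod M, (case x of (S, T) \<Rightarrow> S + M * T) div M) = x"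
    using assms div0 by auto
qed auto

section \<open>\<open>k\<close>-reduced residues\<close>

definition kred_residues :: "nat \<Rightarrow> 'a::field poly \<Rightarrow> 'a poly set" where
  "kred_residues k D = {R. R mod D ^ k = R \<and> kgcd k R (D ^ k) = 1}"

text \<open>A prime-by-prime form of \<open>kgcd k R (D ^ k) = 1\<close>, in which one irreducible
  factor of \<open>D\<close> can be split off at a time.\<close>

definition kcoprime :: "nat \<Rightarrow> 'a::field poly \<Rightarrow> 'a poly \<Rightarrow> bool" where
  "kcoprime k D R \<longleftrightarrow> (\<forall>P. irreducible P \<and> lead_coeff P = 1 \<and> P dvd D \<longrightarrow> \<not> P ^ k dvd R)"

text \<open>If a nonconstant \<open>C ^ k\<close> divides both arguments, any irreducible factor
  \<open>P\<close> of \<open>C\<close> divides \<open>D\<close> and has \<open>P ^ k dvd R\<close>.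
  Conversely such a \<open>P ^ k\<close> is itself a nonconstant common k-th power.\<close>

lemma kgcd_eq_1_iff_kcoprime:
  fixes D :: "'a::field poly"
  assumes k: "k \<ge> 1" and D: "D \<noteq> 0"
  shows "kgcd k R (D ^ k) = 1 \<longleftrightarrow> kcoprime k D R"
proof -
  let ?P = "\<lambda>G. lead_coeff G = 1 \<and> (\<exists>C. G = C ^ k) \<and> G dvd R \<and> G dvd D ^ k"
  have "kgcd k R (D ^ k) = 1 \<longleftrightarrow> is_kgcd k R (D ^ k) 1"
    using is_kgcd_kgcd[OF k, of R "D ^ k"] kgcd_unique[OF k] D by (metis power_not_zero)
  \<comment> \<open>As 1 is always a candidate, it is maximal exactly when every candidate is
    constant.\<close>
  also have "\<dots> \<longleftrightarrow> (\<forall>G. ?P G \<longrightarrow> degree G = 0)"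
    unfolding is_kgcd_def is_arg_max_linorder by (auto intro: exI[of _ 1])
  also have "\<dots> \<longleftrightarrow> kcoprime k D R"
  proof
    assume *: "\<forall>G. ?P G \<longrightarrow> degree G = 0"
    show "kcoprime k D R"
      unfolding kcoprime_def
    proof (intro allI impI notI)
      fix P assume P: "irreducible P \<and> lead_coeff P = 1 \<and> P dvd D" "P ^ k dvd R"
      then have "?P (P ^ k)" by (auto simp: lead_coeff_power dvd_power_same)
      with * have "degree (P ^ k) = 0" by blast
      moreover have "degree (P ^ k) = k * degree P" using P by (intro degree_power_eq) auto
      moreover have "degree P > 0" using P irreducible_poly_degree_pos by blast
      ultimately show False using k by simp
    qed
  next
    assume *: "kcoprime k D R"
    show "\<forall>G. ?P G \<longrightarrow> degree G = 0"
    proof (intro allI impI, rule ccontr)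
      fix G assume G: "?P G" "degree G \<noteq> 0"
      then obtain C where C: "G = C ^ k" by blast
      then have "degree C > 0" using G(2) by (metis degree_power_le gr0I le_zero_eq mult_0)
      then obtain P where P: "irreducible P" "lead_coeff P = 1" "P dvd C"
        using exists_monic_irreducible_dvd by blast
      have "P ^ k dvd C ^ k" using P(3) by (rule dvd_power_same)
      then have "P ^ k dvd R" using C G dvd_trans by blast
      have "P dvd C ^ k" using P(3) k by (meson dvd_power dvd_trans less_le_trans zero_less_one)
      then have "P dvd D" using C G P(1) dvd_trans irreducible_poly_dvd_power by blast
      then show False using * P \<open>P ^ k dvd R\<close> unfolding kcoprime_def by blast
    qed
  qed
  finally show ?thesis .
qed

lemma kcoprime_add_mult:
  "kcoprime k D (S + D ^ k * T) \<longleftrightarrow> kcoprime k D S"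
proof -
  have "P ^ k dvd S + D ^ k * T \<longleftrightarrow> P ^ k dvd S" if "P dvd D" for P
    using that by (meson dvd_add_left_iff dvd_mult2 dvd_power_same)
  then show ?thesis unfolding kcoprime_def by blast
qed

lemma kcoprime_irreducible_mult:
  fixes P M :: "'a::field poly"
  assumes P: "irreducible P" "lead_coeff P = 1"
  shows "kcoprime k (P * M) R \<longleftrightarrow> kcoprime k M R \<and> \<not> P ^ k dvd R"
proof -
  have "Q dvd P * M \<longleftrightarrow> Q = P \<or> Q dvd M" if "irreducible Q" "lead_coeff Q = 1" for Q
    using that P irreducible_poly_dvd_mult[of Q P M] monic_irreducible_dvd_irreducible[of P Q]
    by auto
  then show ?thesis using P unfolding kcoprime_def by blast
qed

section \<open>Lifting reduced residues through one irreducible factor\<close>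

definition fibre_size :: "nat \<Rightarrow> 'a::{field,finite} poly \<Rightarrow> 'a poly \<Rightarrow> nat" where
  "fibre_size k P M = CARD('a) ^ degree (P ^ k) - (if P dvd M then 0 else 1)"

text \<open>If \<open>P\<close> divides \<open>M\<close>, the hypothesis on \<open>S\<close> already
  makes every lift admissible. Otherwise \<open>M ^ k\<close> is invertible modulo
  \<open>P ^ k\<close>, so exactly one residue \<open>T\<close> is bad; this is the 1 subtracted in
  \<open>fibre_size\<close>.\<close>

lemma card_kcoprime_lifts:
  fixes P M :: "'a::{field,finite} poly"
  assumes P: "irreducible P" "lead_coeff P = 1" and S: "kcoprime k M S"
  shows "card {T. T mod P ^ k = T \<and> kcoprime k (P * M) (S + M ^ k * T)} = fibre_size k P M"
proof -
  let ?T = "{T. T mod P ^ k = T}"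
  have Pk: "P ^ k \<noteq> 0" using P by auto
  have eq: "{T. T mod P ^ k = T \<and> kcoprime k (P * M) (S + M ^ k * T)}
      = ?T - {T \<in> ?T. P ^ k dvd S + M ^ k * T}"
    using S by (auto simp: kcoprime_irreducible_mult[OF P] kcoprime_add_mult)
  show ?thesis
  proof (cases "P dvd M")
    case True
    then have "\<not> P ^ k dvd S + M ^ k * T" for T
      using S P kcoprime_add_mult[of k M S T] unfolding kcoprime_def by blast
    then show ?thesis using True unfolding eq fibre_size_def by (simp add: card_residues[OF Pk])
  next
    case False
    have "\<exists>u v. u * P + v * M ^ k = 1"
      using irreducible_poly_comaximal[OF P(1) False] by (rule comaximal_power)
    \<comment> \<open>\<open>comaximal_power\<close> raises only the second entry, so the pair is
      swapped before \<open>P\<close> is raised.\<close>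
    then have "\<exists>u v. u * M ^ k + v * P = 1" by (metis add.commute)
    then have "\<exists>u v. u * M ^ k + v * P ^ k = 1" by (rule comaximal_power)
    then obtain u v where uv: "u * M ^ k + v * P ^ k = 1" by blast
    \<comment> \<open>\<open>u\<close> inverts \<open>M ^ k\<close> modulo \<open>P ^ k\<close>,
      which solves the congruence for \<open>T\<close>.\<close>
    have iff: "P ^ k dvd S + M ^ k * T \<longleftrightarrow> P ^ k dvd T - (- u * S)" for T
    proof
      assume "P ^ k dvd S + M ^ k * T"
      then have "P ^ k dvd u * (S + M ^ k * T) + P ^ k * (v * T)" by simp
      also have "u * (S + M ^ k * T) + P ^ k * (v * T) = u * S + (u * M ^ k + v * P ^ k) * T"
        by (simp add: algebra_simps)
      finally show "P ^ k dvd T - (- u * S)" using uv by (simp add: add.commute)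
    next
      assume "P ^ k dvd T - (- u * S)"
      then have "P ^ k dvd M ^ k * (T - (- u * S)) + P ^ k * (v * S)" by simp
      also have "M ^ k * (T - (- u * S)) + P ^ k * (v * S)
          = M ^ k * T + (u * M ^ k + v * P ^ k) * S"
        by (simp add: algebra_simps)
      finally show "P ^ k dvd S + M ^ k * T" using uv by (simp add: add.commute)
    qed
    have "{T \<in> ?T. P ^ k dvd S + M ^ k * T} = {(- u * S) mod P ^ k}"
      unfolding iff mod_eq_dvd_iff[symmetric] by (auto simp del: mult_minus_left)
    then show ?thesis
      using False card_residues[OF Pk] finite_residues[OF Pk]
      unfolding eq fibre_size_def by (subst card_Diff_subset) auto
  qed
qed

text \<open>Writing residues modulo \<open>(P * M) ^ k\<close> as \<open>S + M ^ k * T\<close>, the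
  value of \<open>f\<close> depends on \<open>S\<close> alone, so the sum over \<open>T\<close> only
  counts admissible lifts.\<close>

lemma sum_kred_residues_irreducible_mult:
  fixes P M :: "'a::{field,finite} poly" and f :: "'a poly \<Rightarrow> complex"
  assumes k: "k \<ge> 1" and P: "irreducible P" "lead_coeff P = 1" and M: "M \<noteq> 0"
    and f: "\<And>R. f (R mod M ^ k) = f R"
  shows "sum f (kred_residues k (P * M)) = of_nat (fibre_size k P M) * sum f (kred_residues k M)"
proof -
  let ?S = "{S. S mod M ^ k = S}" and ?T = "{T. T mod P ^ k = T}"
  let ?h = "\<lambda>(S, T). S + M ^ k * T"
  have Pk: "P ^ k \<noteq> 0" and Mk: "M ^ k \<noteq> 0" and PM: "P * M \<noteq> 0" using P M by auto
  note fin = finite_residues[OF Pk] finite_residues[OF Mk]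
  have fS: "f (S + M ^ k * T) = f S" for S T using f by (metis mod_mult_self2)
  have "finite {R. R mod (P ^ k * M ^ k) = R}" using Pk Mk by (intro finite_residues) simp
  moreover have "kred_residues k (P * M)
      = {R \<in> {R. R mod (P ^ k * M ^ k) = R}. kcoprime k (P * M) R}"
    by (auto simp: kred_residues_def kgcd_eq_1_iff_kcoprime[OF k PM] simp flip: power_mult_distrib)
  ultimately have "sum f (kred_residues k (P * M)) =
      (\<Sum>R | R mod (P ^ k * M ^ k) = R. if kcoprime k (P * M) R then f R else 0)"
    by (simp only: sum.inter_filter)
  also have "\<dots> = (\<Sum>x\<in>?S \<times> ?T. if kcoprime k (P * M) (?h x) then f (?h x) else 0)"
    by (rule sum.reindex_bij_betw[symmetric, OF residues_mult_bij[OF Mk]])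
  also have "\<dots> = (\<Sum>S\<in>?S. \<Sum>T\<in>?T. if kcoprime k (P * M) (S + M ^ k * T) then f S else 0)"
    unfolding sum.cartesian_product by (intro sum.cong refl) (auto simp: fS)
  also have "\<dots> = (\<Sum>S\<in>?S. of_nat (card {T \<in> ?T. kcoprime k (P * M) (S + M ^ k * T)}) * f S)"
    using fin by (simp flip: sum.inter_filter)
  \<comment> \<open>An \<open>S\<close> that is not k-coprime to \<open>M\<close> has no admissible
    lift at all.\<close>
  also have "\<dots> = (\<Sum>S\<in>?S. if kcoprime k M S then of_nat (fibre_size k P M) * f S else 0)"
    using card_kcoprime_lifts[OF P]
    by (intro sum.cong refl) (auto simp: kcoprime_irreducible_mult[OF P] kcoprime_add_mult)
  also have "\<dots> = of_nat (fibre_size k P M) * sum f (kred_residues k M)"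
    using fin unfolding kred_residues_def
    by (simp add: sum_distrib_left kgcd_eq_1_iff_kcoprime[OF k M] flip: sum.inter_filter)
  finally show ?thesis .
qed

section \<open>The function phi_k and the comparison of moduli\<close>

lemma pnorm_irreducible_gt_1:
  fixes P :: "'a::{field,finite} poly"
  assumes "irreducible P"
  shows "pnorm P > 1"
proof -
  have "card {0, 1 :: 'a} \<le> CARD('a)" by (intro card_mono) auto
  then have "real CARD('a) > 1" by simp
  then show ?thesis
    using assms irreducible_poly_degree_pos[OF assms] by (auto simp: pnorm_def one_less_power)
qed

text \<open>No Euler factor vanishes, because |P|^k > 1. This permits cancelling phi_k(N) at the end
  of the main proof.\<close>

lemma phi_nonzero:
  fixes D :: "'a::{field,finite} poly"
  assumes "k \<ge> 1" "D \<noteq> 0"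
  shows "phi k D \<noteq> 0"
proof -
  have "pnorm P ^ k > 1" if "irreducible P" for P :: "'a poly"
    using pnorm_irreducible_gt_1[OF that] assms(1) by (intro one_less_power) auto
  then have "1 - 1 / pnorm P ^ k \<noteq> 0" if "irreducible P" for P :: "'a poly"
    using that by fastforce
  moreover have "finite {P. irreducible P \<and> lead_coeff P = 1 \<and> P dvd D}"
    by (rule finite_subset[OF _ finite_poly_divisors[OF assms(2)]]) auto
  ultimately show ?thesis using assms(2) by (auto simp: phi_def pnorm_def)
qed

text \<open>The recursion matches that of the sums over reduced residues. A repeated factor
  contributes only |P|^k; a new one contributes |P|^k (1 - |P|^(-k)) = |P|^k - 1.\<close>

lemma phi_irreducible_mult:
  fixes P M :: "'a::{field,finite} poly"
  assumes P: "irreducible P" "lead_coeff P = 1" and M: "M \<noteq> 0"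
  shows "phi k (P * M) = real (fibre_size k P M) * phi k M"
proof -
  let ?I = "\<lambda>D. {Q :: 'a poly. irreducible Q \<and> lead_coeff Q = 1 \<and> Q dvd D}"
  have nz: "P \<noteq> 0" using P by auto
  have fin: "finite (?I M)"
    by (rule finite_subset[OF _ finite_poly_divisors[OF M]]) auto
  have I: "?I (P * M) = insert P (?I M)"
    using P irreducible_poly_dvd_mult[of _ P M] monic_irreducible_dvd_irreducible[of P] by auto
  have norm: "pnorm (P * M) = pnorm P * pnorm M"
    using nz M by (simp add: pnorm_def degree_mult_eq power_add)
  have q: "real (CARD('a) ^ degree (P ^ k)) = pnorm P ^ k"
    using nz by (simp add: pnorm_def degree_power_eq mult.commute[of k] flip: power_mult)
  have pos: "pnorm P > 0" using nz by (simp add: pnorm_def)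
  show ?thesis
  proof (cases "P dvd M")
    case True
    then have "?I (P * M) = ?I M" using I P by auto
    then show ?thesis using True q unfolding phi_def fibre_size_def
      by (simp add: norm power_mult_distrib)
  next
    case False
    then have "(\<Prod>Q\<in>?I (P * M). 1 - 1 / pnorm Q ^ k)
        = (1 - 1 / pnorm P ^ k) * (\<Prod>Q\<in>?I M. 1 - 1 / pnorm Q ^ k)"
      unfolding I using fin by simp
    moreover have "real (fibre_size k P M) = pnorm P ^ k - 1"
      using False q unfolding fibre_size_def by (simp add: of_nat_diff Suc_le_eq)
    moreover have "pnorm P ^ k * (1 - 1 / pnorm P ^ k) = pnorm P ^ k - 1"
      using pos by (simp add: field_simps)
    ultimately show ?thesis unfolding phi_def norm power_mult_distrib
      by (metis (no_types, lifting) mult.assoc mult.left_commute)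
  qed
qed

text \<open>When an irreducible \<open>P\<close> is split off \<open>A\<close>, leaving
  \<open>B\<close>, both sides acquire the same factor \<open>fibre_size k P (B * N)\<close>.
  Induction on the degree of \<open>A\<close> thus ends at \<open>A = 1\<close>.\<close>

lemma sum_kred_residues_mult:
  fixes A N :: "'a::{field,finite} poly" and f :: "'a poly \<Rightarrow> complex"
  assumes k: "k \<ge> 1" and A: "lead_coeff A = 1" and N: "N \<noteq> 0"
    and f: "\<And>R. f (R mod N ^ k) = f R"
  shows "of_real (phi k N) * sum f (kred_residues k (A * N))
       = of_real (phi k (A * N)) * sum f (kred_residues k N)"
  using A
proof (induction "degree A" arbitrary: A rule: less_induct)
  case less
  show ?case
  proof (cases "degree A = 0")
    case True
    with less.prems have "A = 1" by (auto elim!: degree_eq_zeroE)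
    then show ?thesis by simp
  next
    case False
    then obtain P where P: "irreducible P" "lead_coeff P = 1" "P dvd A"
      using exists_monic_irreducible_dvd by blast
    then obtain B where B: "A = P * B" by blast
    have monic: "lead_coeff B = 1" using B P(2) less.prems by (simp add: lead_coeff_mult)
    then have nz: "P \<noteq> 0" "B \<noteq> 0" using P by auto
    then have "degree B < degree A"
      using B irreducible_poly_degree_pos[OF P(1)] by (simp add: degree_mult_eq)
    note IH = less.hyps[OF this monic]
    have BN: "B * N \<noteq> 0" using nz N by simp
    \<comment> \<open>A function periodic modulo \<open>N ^ k\<close> is also periodic modulo its
      multiple \<open>(B * N) ^ k\<close>, the modulus of the recursion step.\<close>
    have per: "f (R mod (B * N) ^ k) = f R" for R
      using f by (metis dvd_triv_right mod_mod_cancel power_mult_distrib)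
    from sum_kred_residues_irreducible_mult[where f = f, OF k P(1,2) BN per]
    show ?thesis
      using IH phi_irreducible_mult[OF P(1,2) BN, of k] by (simp add: B mult.assoc)
  qed
qed

section \<open>The character sums\<close>

text \<open>The remainder of \<open>B * X\<close> modulo \<open>B * M\<close> is
  \<open>B * (X mod M)\<close>. Since \<open>B\<close> is monic, its coefficient just below the
  degree of \<open>B * M\<close> is the one of \<open>X mod M\<close> just below the degree of
  \<open>M\<close>.\<close>

lemma tcoeff_mult_monic:
  fixes B M X :: "'a::field poly"
  assumes B: "lead_coeff B = 1" and M: "M \<noteq> 0"
  shows "tcoeff (B * M) (B * X) = tcoeff M X"
proof (cases "degree M = 0")
  case True
  \<comment> \<open>The right side is 0 by convention, but \<open>B * M\<close> may be nonconstant;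
    the left side vanishes because the remainder is 0.\<close>
  then have "M dvd X" using M is_unit_iff_degree unit_imp_dvd by blast
  then show ?thesis using True by (simp add: tcoeff_def mod_mult_mult1)
next
  case False
  let ?Y = "X mod M" and ?n = "degree M - 1"
  have "B \<noteq> 0" using B by auto
  have deg: "degree ?Y \<le> ?n" using degree_mod_less'[OF M, of X] False by (cases "?Y = 0") auto
  have "coeff (B * ?Y) (degree B + ?n) = coeff ?Y ?n"
  proof (cases "degree ?Y = ?n")
    case True
    then show ?thesis using B coeff_mult_degree_sum[of B ?Y] by simp
  next
    case False
    then have "degree ?Y < ?n" using deg by simp
    then show ?thesis using degree_mult_le[of B ?Y] by (simp add: coeff_eq_0)
  qed
  then show ?thesis
    using False M \<open>B \<noteq> 0\<close> by (simp add: tcoeff_def mod_mult_mult1 degree_mult_eq)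
qed

text \<open>The common factor \<open>A ^ k\<close> cancels from argument and modulus of the
  character, leaving a summand periodic modulo \<open>N ^ k\<close>.\<close>

lemma phi_eta_mult:
  fixes A N G :: "'a::{field,finite} poly"
  assumes k: "k \<ge> 1" and A: "lead_coeff A = 1" and N: "N \<noteq> 0"
  shows "of_real (phi k N) * eta lam k (A ^ k * G) (A * N)
       = of_real (phi k (A * N)) * eta lam k G N"
proof -
  have "E_char lam (A ^ k * G) ((A * N) ^ k) R = E_char lam G (N ^ k) R" for R
    using tcoeff_mult_monic[of "A ^ k" "N ^ k" "G * R"] A N
    by (simp add: E_char_def power_mult_distrib mult.assoc lead_coeff_power)
  then show ?thesis
    using sum_kred_residues_mult[OF k A N, of "E_char lam G (N ^ k)"]
    by (simp add: eta_def kred_residues_def E_char_mod)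
qed

theorem theorem3p3:
  fixes lam :: "'a::{field,finite} \<Rightarrow> complex"
    and k :: nat and H D1 D2 :: "'a poly"
  assumes lam_nonzero: "\<And>x. lam x \<noteq> 0"
    and lam_hom: "\<And>x y. lam (x + y) = lam x * lam y"
    and lam_nontrivial: "\<exists>x. lam x \<noteq> 1"
    and k: "k \<ge> 1"
    and monic1: "lead_coeff D1 = 1" and monic2: "lead_coeff D2 = 1"
    and dvd1: "D1 ^ k dvd H" and dvd2: "D2 ^ k dvd H"
  shows "of_real (phi k D2) * eta lam k (H div D2 ^ k) D1
       = of_real (phi k D1) * eta lam k (H div D1 ^ k) D2"
proof -
  obtain g u v where g: "g dvd D1" "g dvd D2" "g = u * D1 + v * D2"
    using poly_bezout by blast
  have "D1 \<noteq> 0" "D2 \<noteq> 0" using monic1 monic2 by auto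
  then have "g \<noteq> 0" using g by auto
  define c where "c = inverse (lead_coeff g)"
  define N where "N = smult c g"
  have c: "c \<noteq> 0" using \<open>g \<noteq> 0\<close> by (simp add: c_def)
  have N: "lead_coeff N = 1" "N \<noteq> 0" using \<open>g \<noteq> 0\<close> c by (auto simp: N_def c_def)
  have "N dvd D1" "N dvd D2" using g c by (simp_all add: N_def smult_dvd_iff)
  then obtain A B where AB: "D1 = N * A" "D2 = N * B" by (metis dvdE)
  have monic: "lead_coeff A = 1" "lead_coeff B = 1"
    using AB monic1 monic2 N by (simp_all add: lead_coeff_mult)
  have "N = smult c u * D1 + smult c v * D2"
    by (simp add: N_def g(3) smult_add_right)
  \<comment> \<open>Cancelling \<open>N\<close> from its Bezout representation makes the cofactors
    \<open>A\<close> and \<open>B\<close> comaximal, as \<open>kth_power_lcm\<close>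
    requires.\<close>
  then have "N * (smult c u * A + smult c v * B) = N * 1"
    unfolding AB by (simp add: algebra_simps)
  then have "\<exists>u v. u * A + v * B = 1" using N(2) by (metis mult_left_cancel)
  from kth_power_lcm[OF this] dvd1 dvd2 AB have "(N * A * B) ^ k dvd H" by blast
  then obtain G where H: "H = (N * A * B) ^ k * G" by blast
  have H2: "H = D2 ^ k * (A ^ k * G)" and H1: "H = D1 ^ k * (B ^ k * G)"
    using H AB by (simp_all add: power_mult_distrib mult_ac)
  have div: "H div D2 ^ k = A ^ k * G" "H div D1 ^ k = B ^ k * G"
    using \<open>D1 \<noteq> 0\<close> \<open>D2 \<noteq> 0\<close> by (subst H2, simp, subst H1, simp)
  have "of_real (phi k N) * eta lam k (A ^ k * G) D1 = of_real (phi k D1) * eta lam k G N"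
    and "of_real (phi k N) * eta lam k (B ^ k * G) D2 = of_real (phi k D2) * eta lam k G N"
    using phi_eta_mult[OF k monic(1) N(2)] phi_eta_mult[OF k monic(2) N(2)] AB
    by (simp_all add: mult.commute)
  \<comment> \<open>Both sides equal \<open>phi k D1 * phi k D2 * eta lam k G N\<close>.\<close>
  then have "of_real (phi k N) * (of_real (phi k D2) * eta lam k (H div D2 ^ k) D1)
      = of_real (phi k N) * (of_real (phi k D1) * eta lam k (H div D1 ^ k) D2)"
    unfolding div by (metis mult.left_commute)
  moreover have "complex_of_real (phi k N) \<noteq> 0" using phi_nonzero[OF k N(2)] by simp
  ultimately show ?thesis by (metis mult_left_cancel)
qed

end
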